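(* Let $\Phi=(G,\varphi)$ be a $\mathbb{T}$-gain graph of order $n$. Then $\lambda_1(\Phi)\le \nu(\Phi)$ and $\lambda_1(\Phi)\le\epsilon(\Phi)$, where $\lambda_1(\Phi)$ is the smallest eigenvalue of the gain Laplacian $\mathbf{L}(\Phi)$, $\nu(\Phi)$ is the frustration number of $\Phi$, and $\epsilon(\Phi)$ is the frustration index of $\Phi$.
   Context: A $\mathbb{T}$-gain graph (complex unit gain graph) $\Phi=(G,\varphi)$ consists of a finite simple undirected graph $G$ with vertices $v_1,\dots,v_n$ and a map $\varphi$ assigning to each oriented edge $\overrightarrow{e}_{ij}$ (from $v_i$ to $v_j$, where $v_i\sim v_j$) a complex number of modulus $1$, with $\varphi(\overrightarrow{e}_{ji})=\varphi(\overrightarrow{e}_{ij})^{-1}$. Its adjacency matrix $\mathbf{A}(\Phi)=(a_{ij})$ is the Hermitian matrix with $a_{ij}=\varphi(\overrightarrow{e}_{ij})$ if $v_i\sim v_j$ and $a_{ij}=0$ otherwise. The gain Laplacian is $\mathbf{L}(\Phi)=\mathbf{D}(G)-\mathbf{A}(\Phi)$, where $\mathbf{D}(G)$ is the diagonal matrix of vertex degrees of $G$; it is Hermitian positive semidefinite with eigenvalues $0\le\lambda_1(\Phi)\le\dots\le\lambda_n(\Phi)$. The gain of an oriented cycle is the product of the gains of its successive oriented edges; $\Phi$ is balanced if every cycle (if any) has gain $1$. The frustration number $\nu(\Phi)$ (resp. frustration index $\epsilon(\Phi)$) is the minimum number of vertices (resp. edges) whose deletion from $\Phi$ yields a balanced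 gain graph. *)

theory Defs
  imports "Graph_Theory.Pair_Digraph" "Jordan_Normal_Form.Char_Poly" Complex_Main
begin

text \<open>A \<^locale>\<open>pair_graph\<close> is a finite, loopless digraph without parallel arcs whose arc set is
  symmetric, i.e. a finite simple undirected graph given by its oriented edges: \<open>(x, y)\<close> is the
  oriented edge from \<open>x\<close> to \<open>y\<close>, and \<open>{x, y}\<close> the underlying edge. The gain of a pair that is not
  an oriented edge is unconstrained and never used.\<close>

locale gain_graph = pair_graph G
  for G :: "'a pair_pre_digraph" +
  fixes \<phi> :: "'a \<times> 'a \<Rightarrow> complex"
  assumes gain_unit: "(x, y) \<in> parcs G \<Longrightarrow> cmod (\<phi> (x, y)) = 1"
    and gain_reverse: "(x, y) \<in> parcs G \<Longrightarrow> \<phi> (y, x) = inverse (\<phi> (x, y))"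

definition walk_gain :: "('a \<times> 'a \<Rightarrow> complex) \<Rightarrow> ('a \<times> 'a) awalk \<Rightarrow> complex" where
  "walk_gain \<phi> p = prod_list (map \<phi> p)"

text \<open>In a symmetric digraph \<^const>\<open>pre_digraph.cycle\<close> also admits the closed walks
  \<open>x, y, x\<close>, which are not cycles of the undirected graph; hence the length bound.\<close>

definition balanced :: "'a pair_pre_digraph \<Rightarrow> ('a \<times> 'a \<Rightarrow> complex) \<Rightarrow> bool" where
  "balanced G \<phi> \<longleftrightarrow>
    (\<forall>p. pre_digraph.cycle (with_proj G) p \<and> 3 \<le> length p \<longrightarrow> walk_gain \<phi> p = 1)"

definition undirected_edges :: "'a pair_pre_digraph \<Rightarrow> 'a set set" where
  "undirected_edges G = {{x, y} |x y. (x, y) \<in> parcs G}"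

definition delete_verts :: "'a pair_pre_digraph \<Rightarrow> 'a set \<Rightarrow> 'a pair_pre_digraph" where
  "delete_verts G S =
    \<lparr> pverts = pverts G - S, parcs = {(x, y) \<in> parcs G. x \<notin> S \<and> y \<notin> S} \<rparr>"

definition delete_edges :: "'a pair_pre_digraph \<Rightarrow> 'a set set \<Rightarrow> 'a pair_pre_digraph" where
  "delete_edges G F = \<lparr> pverts = pverts G, parcs = {(x, y) \<in> parcs G. {x, y} \<notin> F} \<rparr>"

definition frustration_number :: "'a pair_pre_digraph \<Rightarrow> ('a \<times> 'a \<Rightarrow> complex) \<Rightarrow> nat" where
  "frustration_number G \<phi> =
    (LEAST k. \<exists>S. S \<subseteq> pverts G \<and> card S = k \<and> balanced (delete_verts G S) \<phi>)"

definition frustration_index :: "'a pair_pre_digraph \<Rightarrow> ('a \<times> 'a \<Rightarrow> complex) \<Rightarrow> nat" where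
  "frustration_index G \<phi> =
    (LEAST k. \<exists>F. F \<subseteq> undirected_edges G \<and> card F = k \<and> balanced (delete_edges G F) \<phi>)"

text \<open>The matrices depend on a numbering \<open>v 0, \<dots>, v (n - 1)\<close> of the vertices.\<close>

definition adjacency_matrix ::
    "'a pair_pre_digraph \<Rightarrow> ('a \<times> 'a \<Rightarrow> complex) \<Rightarrow> nat \<Rightarrow> (nat \<Rightarrow> 'a) \<Rightarrow> complex mat" where
  "adjacency_matrix G \<phi> n v =
    mat n n (\<lambda>(i, j). if (v i, v j) \<in> parcs G then \<phi> (v i, v j) else 0)"

text \<open>In a \<^locale>\<open>pair_graph\<close> every edge at a vertex is the tail of exactly one arc there, so the
  out-degree is the degree in the undirected graph.\<close>

definition degree_matrix :: "'a pair_pre_digraph \<Rightarrow> nat \<Rightarrow> (nat \<Rightarrow> 'a) \<Rightarrow> complex mat" where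
  "degree_matrix G n v =
    mat n n (\<lambda>(i, j). if i = j then of_nat (out_degree (with_proj G) (v i)) else 0)"

definition gain_laplacian ::
    "'a pair_pre_digraph \<Rightarrow> ('a \<times> 'a \<Rightarrow> complex) \<Rightarrow> nat \<Rightarrow> (nat \<Rightarrow> 'a) \<Rightarrow> complex mat" where
  "gain_laplacian G \<phi> n v = degree_matrix G n v - adjacency_matrix G \<phi> n v"

text \<open>Meant for Hermitian matrices of positive dimension, whose eigenvalues are all real; the set
  below is then finite and nonempty.\<close>

definition smallest_eigenvalue :: "complex mat \<Rightarrow> real" where
  "smallest_eigenvalue A = Min {x. eigenvalue A (complex_of_real x)}"

lemma gain_graph_delete_verts:
  assumes "gain_graph G \<phi>"
  shows "gain_graph (delete_verts G S) \<phi>"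
proof -
  interpret G: gain_graph G \<phi> by fact
  have fin: "finite {(x, y) \<in> parcs G. x \<notin> S \<and> y \<notin> S}"
    by (rule finite_subset[OF _ G.pair_finite_arcs]) blast
  have sym: "sym {(x, y) \<in> parcs G. x \<notin> S \<and> y \<notin> S}"
    by (rule symI) (use G.arcs_symmetric in blast)
  show ?thesis
  proof unfold_locales
    fix e assume e: "e \<in> parcs (delete_verts G S)"
    then obtain x y where [simp]: "e = (x, y)" and xy: "(x, y) \<in> parcs G" "x \<notin> S" "y \<notin> S"
      unfolding delete_verts_def by auto
    show "fst e \<in> pverts (delete_verts G S)" and "snd e \<in> pverts (delete_verts G S)"
      using xy G.in_arcsD1[OF xy(1)] G.in_arcsD2[OF xy(1)] by (simp_all add: delete_verts_def)
    show "fst e \<noteq> snd e" using G.no_loops'[OF xy(1)] by simp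
  next
    show "finite (pverts (delete_verts G S))" and "finite (parcs (delete_verts G S))"
      using fin G.pair_finite_verts by (simp_all add: delete_verts_def)
    show "symmetric (with_proj (delete_verts G S))"
      using sym by (simp add: symmetric_def delete_verts_def)
  next
    fix x y assume "(x, y) \<in> parcs (delete_verts G S)"
    then have "(x, y) \<in> parcs G" by (simp add: delete_verts_def)
    then show "cmod (\<phi> (x, y)) = 1" and "\<phi> (y, x) = inverse (\<phi> (x, y))"
      by (rule G.gain_unit, rule G.gain_reverse)
  qed
qed

lemma gain_graph_delete_edges:
  assumes "gain_graph G \<phi>"
  shows "gain_graph (delete_edges G F) \<phi>"
proof -
  interpret G: gain_graph G \<phi> by fact
  have fin: "finite {(x, y) \<in> parcs G. {x, y} \<notin> F}"
    by (rule finite_subset[OF _ G.pair_finite_arcs]) blast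
  have sym: "sym {(x, y) \<in> parcs G. {x, y} \<notin> F}"
    by (rule symI) (use G.arcs_symmetric in \<open>auto simp: insert_commute\<close>)
  show ?thesis
  proof unfold_locales
    fix e assume e: "e \<in> parcs (delete_edges G F)"
    then obtain x y where [simp]: "e = (x, y)" and xy: "(x, y) \<in> parcs G" "{x, y} \<notin> F"
      unfolding delete_edges_def by auto
    show "fst e \<in> pverts (delete_edges G F)" and "snd e \<in> pverts (delete_edges G F)"
      using xy G.in_arcsD1[OF xy(1)] G.in_arcsD2[OF xy(1)] by (simp_all add: delete_edges_def)
    show "fst e \<noteq> snd e" using G.no_loops'[OF xy(1)] by simp
  next
    show "finite (pverts (delete_edges G F))" and "finite (parcs (delete_edges G F))"
      using fin G.pair_finite_verts by (simp_all add: delete_edges_def)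
    show "symmetric (with_proj (delete_edges G F))"
      using sym by (simp add: symmetric_def delete_edges_def)
  next
    fix x y assume "(x, y) \<in> parcs (delete_edges G F)"
    then have "(x, y) \<in> parcs G" by (simp add: delete_edges_def)
    then show "cmod (\<phi> (x, y)) = 1" and "\<phi> (y, x) = inverse (\<phi> (x, y))"
      by (rule G.gain_unit, rule G.gain_reverse)
  qed
qed

lemma gain_laplacian_hermitian:
  assumes "gain_graph G \<phi>" and "i < n" and "j < n"
  shows "gain_laplacian G \<phi> n v $$ (j, i) = cnj (gain_laplacian G \<phi> n v $$ (i, j))"
proof -
  interpret G: gain_graph G \<phi> by fact
  have rev: "\<phi> (y, x) = cnj (\<phi> (x, y))" if "(x, y) \<in> parcs G" for x y
  proof -
    have "\<phi> (x, y) * cnj (\<phi> (x, y)) = 1"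
      using G.gain_unit[OF that] by (simp add: complex_norm_square[symmetric])
    then show ?thesis using G.gain_reverse[OF that] by (simp add: inverse_unique)
  qed
  show ?thesis
    using assms(2,3) rev[of "v i" "v j"] G.arcs_symmetric[of "v i" "v j"]
      G.arcs_symmetric[of "v j" "v i"]
    by (cases "(v i, v j) \<in> parcs G")
      (auto simp: gain_laplacian_def degree_matrix_def adjacency_matrix_def)
qed

end

theory Submission
  imports "HOL-Analysis.Function_Topology" "HOL-Analysis.Topology_Euclidean_Space" Defs
begin

text \<open>By the Rayleigh principle \<open>\<lambda>\<^sub>1 |x|\<^sup>2 \<le> x\<^sup>* L x\<close> for every \<open>x\<close>. Let \<open>S\<close> be a smallest vertex set with
  balanced complement. The complement carries a unit potential \<open>\<theta>\<close> with \<open>\<theta> x = \<phi> (x, y) \<theta> y\<close> on its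
  arcs; test with \<open>\<theta>\<close> extended by \<open>0\<close> on \<open>S\<close>. Only the edges between \<open>S\<close> and its complement
  contribute, one each, so \<open>\<lambda>\<^sub>1 (n - |S|) \<le> |S| (n - |S|)\<close>, where \<open>|S| < n\<close> since a single vertex is
  balanced. The edge bound follows from \<open>\<nu> \<le> \<epsilon>\<close>: delete one endpoint of each deleted edge.\<close>

section \<open>Hermitian forms and the Rayleigh principle\<close>

text \<open>The sesquilinear form \<open>y* a z\<close>. Vectors are functions on
  \<open>nat\<close>, read only below \<open>n\<close>, so that the product topology serves the
  compactness argument.\<close>

definition herm_form :: "nat \<Rightarrow> (nat \<Rightarrow> nat \<Rightarrow> complex) \<Rightarrow> (nat \<Rightarrow> complex) \<Rightarrow> (nat \<Rightarrow> complex) \<Rightarrow> complex" where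
  "herm_form n a y z = (\<Sum>i<n. \<Sum>j<n. cnj (y i) * a i j * z j)"

lemma herm_form_add_left: "herm_form n a (\<lambda>i. x i + y i) z = herm_form n a x z + herm_form n a y z"
  by (simp add: herm_form_def algebra_simps sum.distrib)

lemma herm_form_add_right: "herm_form n a z (\<lambda>i. x i + y i) = herm_form n a z x + herm_form n a z y"
  by (simp add: herm_form_def algebra_simps sum.distrib)

lemma herm_form_scale_left: "herm_form n a (\<lambda>i. c * x i) y = cnj c * herm_form n a x y"
  by (simp add: herm_form_def algebra_simps sum_distrib_left)

lemma herm_form_scale_right: "herm_form n a x (\<lambda>i. c * y i) = c * herm_form n a x y"
  by (simp add: herm_form_def algebra_simps sum_distrib_left)

lemma herm_form_commute:
  assumes "\<And>i j. i < n \<Longrightarrow> j < n \<Longrightarrow> a j i = cnj (a i j)"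
  shows "herm_form n a x y = cnj (herm_form n a y x)"
proof -
  have conj: "cnj (a j i) = a i j" if "i < n" "j < n" for i j
    using assms[OF that] by simp
  have "cnj (herm_form n a y x) = (\<Sum>j<n. \<Sum>i<n. y j * a i j * cnj (x i))"
    by (simp add: herm_form_def conj)
  also have "\<dots> = (\<Sum>i<n. \<Sum>j<n. y j * a i j * cnj (x i))"
    by (rule sum.swap)
  finally show ?thesis
    by (simp add: herm_form_def mult_ac)
qed

lemma herm_form_eq_sum_image:
  "herm_form n a y z = (\<Sum>i<n. cnj (y i) * (\<Sum>j<n. a i j * z j))"
  by (simp add: herm_form_def sum_distrib_left mult.assoc)

text \<open>Stands in for differentiating at a minimum: applied to \<open>a\<close> minus
  \<open>m\<close> times the identity, it turns a minimiser of the Rayleigh quotient into an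
  eigenvector.\<close>

lemma psd_herm_form_isotropic_imp_kernel:
  assumes herm: "\<And>i j. i < n \<Longrightarrow> j < n \<Longrightarrow> a j i = cnj (a i j)"
    and psd: "\<And>y. 0 \<le> Re (herm_form n a y y)"
    and iso: "Re (herm_form n a x x) = 0"
    and i: "i < n"
  shows "(\<Sum>j<n. a i j * x j) = 0"
proof -
  define w where "w = (\<lambda>i. \<Sum>j<n. a i j * x j)"
  define N where "N = (\<Sum>i<n. (cmod (w i))\<^sup>2)"
  define Q where "Q = Re (herm_form n a w w)"
  \<comment> \<open>\<open>w\<close> is the image of \<open>x\<close>, so this mixed term is
    \<open>w* w\<close>; being real, it equals the other mixed term by Hermitian symmetry.\<close>
  have wx: "herm_form n a w x = complex_of_real N"
    unfolding herm_form_eq_sum_image N_def w_def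
    by (simp add: complex_norm_square mult.commute del: of_real_sum of_real_power)
       (simp add: of_real_sum complex_norm_square mult.commute del: of_real_power)
  have xw: "herm_form n a x w = complex_of_real N"
    by (subst herm_form_commute[OF herm]) (simp_all add: wx)
  \<comment> \<open>With \<open>w = a x\<close>, the form at \<open>x + t w\<close> has linear part \<open>2 t |w|\<^sup>2\<close>, so \<open>w \<noteq> 0\<close> would make it
    negative for small \<open>t < 0\<close>.\<close>
  have ineq: "0 \<le> 2 * t * N + t\<^sup>2 * Q" for t :: real
    using psd[of "\<lambda>i. x i + complex_of_real t * w i"] iso
    by (simp add: herm_form_add_left herm_form_add_right herm_form_scale_left
        herm_form_scale_right wx xw Q_def power2_eq_square algebra_simps)
  have N0: "0 \<le> N" unfolding N_def by (simp add: sum_nonneg)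
  have Q0: "0 \<le> Q" unfolding Q_def by (rule psd)
  have "N = 0"
  proof (rule ccontr)
    assume "N \<noteq> 0"
    then have N: "0 < N" using N0 by simp
    \<comment> \<open>The \<open>+ 1\<close> keeps the denominator positive even if
      \<open>Q = 0\<close>; since \<open>t * Q \<ge> - N\<close>, the factor
      \<open>2 * N + t * Q\<close> stays positive.\<close>
    define t where "t = - N / (Q + 1)"
    have t: "t < 0" using N Q0 by (simp add: t_def divide_neg_pos)
    have "t * Q \<ge> - N"
      using N Q0 by (simp add: t_def field_simps)
    then have "0 < 2 * N + t * Q" using N by simp
    then have "t * (2 * N + t * Q) < 0" using t by (rule mult_neg_pos[rotated])
    then show False using ineq[of t] by (simp add: power2_eq_square algebra_simps)
  qed
  then have "(cmod (w i))\<^sup>2 = 0"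
    unfolding N_def using i by (subst (asm) sum_nonneg_eq_0_iff) auto
  then show ?thesis by (simp add: w_def)
qed

text \<open>Tychonoff: the set is closed and lies in a product of closed unit discs, the coordinates
  from \<open>n\<close> on being pinned to 0.\<close>

lemma compact_finite_unit_sphere:
  "compact {x :: nat \<Rightarrow> complex. (\<Sum>i<n. (cmod (x i))\<^sup>2) = 1 \<and> (\<forall>i\<ge>n. x i = 0)}" (is "compact ?K")
proof -
  let ?P = "PiE UNIV (\<lambda>i::nat. cball (0::complex) 1)"
  have "compactin (product_topology (\<lambda>i::nat. euclidean) UNIV) ?P"
    by (subst compactin_PiE) (simp add: compact_cball)
  then have P: "compact ?P"
    by (simp add: euclidean_product_topology)
  have c: "closed ?K"
  proof -
    have "?K = {x. (\<Sum>i<n. (cmod (x i))\<^sup>2) = 1} \<inter> (\<Inter>i\<in>{n..}. {x. x i = 0})"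
      by auto
    moreover have "closed {x :: nat \<Rightarrow> complex. (\<Sum>i<n. (cmod (x i))\<^sup>2) = 1}"
      by (intro closed_Collect_eq continuous_intros continuous_on_product_coordinates)
    moreover have "closed {x :: nat \<Rightarrow> complex. x i = 0}" for i
      by (intro closed_Collect_eq continuous_intros continuous_on_product_coordinates)
    ultimately show ?thesis by (auto intro!: closed_Int closed_INT)
  qed
  have "?K \<subseteq> ?P"
  proof
    fix x assume x: "x \<in> ?K"
    have "cmod (x i) \<le> 1" for i
    proof (cases "i < n")
      case True
      have "(cmod (x i))\<^sup>2 \<le> (\<Sum>i<n. (cmod (x i))\<^sup>2)"
        by (rule member_le_sum) (use True in auto)
      then show ?thesis using x by (simp add: power2_le_iff_abs_le abs_square_le_1)
    qed (use x in auto)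
    then show "x \<in> ?P" by auto
  qed
  then have "?K = ?P \<inter> ?K" by auto
  then show ?thesis using compact_Int_closed[OF P c] by simp
qed

text \<open>The form attains its minimum \<open>m\<close> on the compact unit sphere at some
  \<open>x\<close>. Homogeneity spreads the bound to all \<open>y\<close>; subtracting
  \<open>m\<close> times the identity leaves a positive semidefinite form that vanishes at
  \<open>x\<close>, so \<open>x\<close> lies in its kernel.\<close>

lemma hermitian_minimal_eigenvector:
  assumes n: "1 \<le> n"
    and herm: "\<And>i j. i < n \<Longrightarrow> j < n \<Longrightarrow> a j i = cnj (a i j)"
  obtains x :: "nat \<Rightarrow> complex" and m :: real where
    "\<exists>i<n. x i \<noteq> 0"
    "\<And>i. i < n \<Longrightarrow> (\<Sum>j<n. a i j * x j) = complex_of_real m * x i"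
    "\<And>y. m * (\<Sum>i<n. (cmod (y i))\<^sup>2) \<le> Re (herm_form n a y y)"
proof -
  define N where "N = (\<lambda>y. \<Sum>i<n. (cmod (y i :: complex))\<^sup>2)"
  define K where "K = {x :: nat \<Rightarrow> complex. N x = 1 \<and> (\<forall>i\<ge>n. x i = 0)}"
  have K: "compact K"
    unfolding K_def N_def by (rule compact_finite_unit_sphere)
  \<comment> \<open>The first unit vector, whose norm is 1 because \<open>1 \<le> n\<close>.\<close>
  have "(\<lambda>i. if i = 0 then 1 else 0) \<in> K"
    using n unfolding K_def N_def by (simp add: if_distrib[of cmod] if_distrib[of "\<lambda>x. x\<^sup>2"] cong: if_cong)
  then have "K \<noteq> {}" by blast
  moreover have "continuous_on K (\<lambda>y. Re (herm_form n a y y))"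
    unfolding herm_form_def
    by (intro continuous_intros continuous_on_subset[OF continuous_on_product_coordinates subset_UNIV])
  ultimately obtain x where x: "x \<in> K"
    and min: "\<And>y. y \<in> K \<Longrightarrow> Re (herm_form n a x x) \<le> Re (herm_form n a y y)"
    using continuous_attains_inf[OF K] by blast
  define m where "m = Re (herm_form n a x x)"
  have Nx: "N x = 1" using x by (simp add: K_def)
  have bound: "m * N y \<le> Re (herm_form n a y y)" for y
  proof (cases "N y = 0")
    case True
    then have "y i = 0" if "i < n" for i
      unfolding N_def using that by (subst (asm) sum_nonneg_eq_0_iff) auto
    then have "herm_form n a y y = 0"
      unfolding herm_form_def by (auto intro!: sum.neutral)
    then show ?thesis using True by simp
  next
    case False
    have pos: "0 < N y" using False unfolding N_def
      by (simp add: sum_nonneg order_less_le)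
    \<comment> \<open>\<open>y\<close> is normalised and cut off at \<open>n\<close> to land in
      \<open>K\<close>; the form does not see the coordinates that are cut off.\<close>
    define s where "s = complex_of_real (1 / sqrt (N y))"
    define z where "z = (\<lambda>i. if i < n then s * y i else 0)"
    have s2: "(cmod s)\<^sup>2 = 1 / N y" using pos by (simp add: s_def power_divide norm_divide)
    have "N z = (\<Sum>i<n. (cmod s)\<^sup>2 * (cmod (y i))\<^sup>2)"
      unfolding N_def z_def by (simp add: norm_mult power_mult_distrib)
    also have "\<dots> = 1" using pos by (simp add: s2 N_def flip: sum_divide_distrib)
    finally have "z \<in> K" by (simp add: K_def z_def)
    then have "m \<le> Re (herm_form n a z z)" unfolding m_def by (rule min)
    also have "herm_form n a z z = herm_form n a (\<lambda>i. s * y i) (\<lambda>i. s * y i)"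
      unfolding herm_form_def z_def by simp
    also have "\<dots> = complex_of_real ((cmod s)\<^sup>2) * herm_form n a y y"
      by (simp add: herm_form_scale_left herm_form_scale_right complex_norm_square mult_ac
          del: of_real_power)
    finally show ?thesis using pos by (simp add: s2 field_simps)
  qed
  define b where "b = (\<lambda>i j. a i j - (if i = j then complex_of_real m else 0))"
  have image: "(\<Sum>j<n. b i j * y j) = (\<Sum>j<n. a i j * y j) - complex_of_real m * y i"
    if "i < n" for i and y :: "nat \<Rightarrow> complex"
    using that by (simp add: b_def left_diff_distrib sum_subtractf if_distrib[of "\<lambda>c. c * _"] cong: if_cong)
  have form: "Re (herm_form n b y y) = Re (herm_form n a y y) - m * N y" for y
  proof -
    have "herm_form n b y y
      = (\<Sum>i<n. cnj (y i) * (\<Sum>j<n. a i j * y j) - complex_of_real (m * (cmod (y i))\<^sup>2))"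
      unfolding herm_form_eq_sum_image
    proof (rule sum.cong[OF refl])
      fix i assume "i \<in> {..<n}"
      then show "cnj (y i) * (\<Sum>j<n. b i j * y j)
        = cnj (y i) * (\<Sum>j<n. a i j * y j) - complex_of_real (m * (cmod (y i))\<^sup>2)"
        by (simp add: image[of i y] complex_norm_square right_diff_distrib del: of_real_power)
    qed
    then show ?thesis
      by (simp add: sum_subtractf herm_form_eq_sum_image N_def sum_distrib_left)
  qed
  have ker: "(\<Sum>j<n. b i j * x j) = 0" if "i < n" for i
  proof (rule psd_herm_form_isotropic_imp_kernel[OF _ _ _ that])
    show "b j i = cnj (b i j)" if "i < n" "j < n" for i j
      using herm[OF that] by (simp add: b_def)
    show "0 \<le> Re (herm_form n b y y)" for y
      using bound[of y] by (simp add: form)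
    show "Re (herm_form n b x x) = 0"
      by (simp add: form Nx m_def)
  qed
  show thesis
  proof (rule that)
    show "\<exists>i<n. x i \<noteq> 0"
    proof (rule ccontr)
      assume "\<not> ?thesis"
      then have "N x = 0" by (simp add: N_def)
      then show False using Nx by simp
    qed
    show "(\<Sum>j<n. a i j * x j) = complex_of_real m * x i" if "i < n" for i
      using ker[OF that] image[OF that, of x] by simp
    show "m * (\<Sum>i<n. (cmod (y i))\<^sup>2) \<le> Re (herm_form n a y y)" for y
      using bound[of y] by (simp add: N_def)
  qed
qed

text \<open>The minimum \<open>m\<close> of the Rayleigh quotient is an eigenvalue, so
  \<open>smallest_eigenvalue A \<le> m\<close>, and \<open>m\<close> bounds the form from
  below.\<close>

lemma smallest_eigenvalue_le_rayleigh:
  assumes A: "A \<in> carrier_mat n n" and n: "1 \<le> n"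
    and herm: "\<And>i j. i < n \<Longrightarrow> j < n \<Longrightarrow> A $$ (j, i) = cnj (A $$ (i, j))"
  shows "smallest_eigenvalue A * (\<Sum>i<n. (cmod (y i))\<^sup>2)
    \<le> Re (herm_form n (\<lambda>i j. A $$ (i, j)) y y)"
proof -
  obtain x m where x: "\<exists>i<n. x i \<noteq> 0"
    and eig: "\<And>i. i < n \<Longrightarrow> (\<Sum>j<n. A $$ (i, j) * x j) = complex_of_real m * x i"
    and bound: "\<And>y. m * (\<Sum>i<n. (cmod (y i))\<^sup>2) \<le> Re (herm_form n (\<lambda>i j. A $$ (i, j)) y y)"
  proof (rule hermitian_minimal_eigenvector[where a = "\<lambda>i j. A $$ (i, j)", OF n])
    show "A $$ (j, i) = cnj (A $$ (i, j))" if "i < n" "j < n" for i j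
      using that by (rule herm)
  qed (rule that)
  have "eigenvector A (vec n x) (complex_of_real m)"
    unfolding eigenvector_def
  proof (intro conjI)
    show "vec n x \<in> carrier_vec (dim_row A)" using A by simp
    show "vec n x \<noteq> 0\<^sub>v (dim_row A)"
    proof
      assume "vec n x = 0\<^sub>v (dim_row A)"
      then have "vec n x $ i = 0" if "i < n" for i using that A by simp
      then show False using x by auto
    qed
    show "A *\<^sub>v vec n x = complex_of_real m \<cdot>\<^sub>v vec n x"
    proof (rule eq_vecI)
      fix i assume "i < dim_vec (complex_of_real m \<cdot>\<^sub>v vec n x)"
      then have i: "i < n" by simp
      have "(A *\<^sub>v vec n x) $ i = (\<Sum>j<n. A $$ (i, j) * x j)"
        using A i by (auto simp: scalar_prod_def atLeast0LessThan intro!: sum.cong)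
      then show "(A *\<^sub>v vec n x) $ i = (complex_of_real m \<cdot>\<^sub>v vec n x) $ i"
        using i eig[OF i] by simp
    qed (use A in simp)
  qed
  then have ev: "eigenvalue A (complex_of_real m)"
    unfolding eigenvalue_def by blast
  \<comment> \<open>\<open>Min\<close> is controlled only on finite sets; the characteristic
    polynomial is monic, hence nonzero, and has finitely many roots.\<close>
  have "finite {z. poly (char_poly A) z = 0}"
    by (rule poly_roots_finite) (use degree_monic_char_poly[OF A] in auto)
  then have "finite (complex_of_real -` {z. poly (char_poly A) z = 0})"
    by (rule finite_vimageI) (simp add: inj_on_def)
  then have "finite {x. eigenvalue A (complex_of_real x)}"
    by (simp add: eigenvalue_root_char_poly[OF A] vimage_def)
  then have "smallest_eigenvalue A \<le> m"
    unfolding smallest_eigenvalue_def by (rule Min_le) (simp add: ev)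
  then have "smallest_eigenvalue A * (\<Sum>i<n. (cmod (y i))\<^sup>2) \<le> m * (\<Sum>i<n. (cmod (y i))\<^sup>2)"
    by (rule mult_right_mono) (simp add: sum_nonneg)
  then show ?thesis using bound[of y] by linarith
qed

section \<open>Balance and potentials\<close>

text \<open>Every cycle of the smaller graph is a cycle of the larger one, with the same
  gain.\<close>

lemma balanced_subgraph:
  assumes "balanced H \<phi>" "pverts G \<subseteq> pverts H" "parcs G \<subseteq> parcs H"
  shows "balanced G \<phi>"
proof -
  have "pre_digraph.cycle (with_proj H) p" if "pre_digraph.cycle (with_proj G) p" for p
    using that assms(2,3)
    by (auto simp: pre_digraph.cycle_def pre_digraph.awalk_def cas_with_proj_eq awalk_verts_with_proj_eq)
  then show ?thesis using assms(1) by (simp add: balanced_def)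
qed

text \<open>The arc equations telescope along the walk.\<close>

lemma (in gain_graph) potential_along_awalk:
  assumes pot: "\<And>x y. (x, y) \<in> parcs G \<Longrightarrow> \<theta> x = \<phi> (x, y) * \<theta> y"
    and "awalk u p w"
  shows "\<theta> u = walk_gain \<phi> p * \<theta> w"
  using assms(2)
proof (induction p arbitrary: u)
  case Nil
  then show ?case by (simp add: awalk_Nil_iff walk_gain_def)
next
  case (Cons e p)
  then obtain x y where e: "e = (x, y)" by (cases e)
  with Cons.prems have "u = x" "(x, y) \<in> parcs G" "awalk y p w"
    by (auto simp: awalk_Cons_iff)
  then show ?case
    using Cons.IH[of y] pot[of x y] by (simp add: e walk_gain_def)
qed

lemma (in gain_graph) gain_mult_reverse:
  assumes "(x, y) \<in> parcs G"
  shows "\<phi> (x, y) * \<phi> (y, x) = 1"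
proof -
  have "\<phi> (x, y) \<noteq> 0" using gain_unit[OF assms] by auto
  then show ?thesis using gain_reverse[OF assms] by simp
qed

text \<open>Induction on the number of arcs, removing one edge \<open>{x, y}\<close>: if \<open>x\<close> and \<open>y\<close> stay connected, the
  cycle through \<open>{x, y}\<close> has gain 1, which is the condition on that edge; otherwise the potential
  may be rescaled on the component of \<open>y\<close>.\<close>

lemma balanced_potential:
  assumes "gain_graph G \<phi>" "balanced G \<phi>"
  shows "\<exists>\<theta>. (\<forall>x. cmod (\<theta> x) = 1) \<and> (\<forall>x y. (x, y) \<in> parcs G \<longrightarrow> \<theta> x = \<phi> (x, y) * \<theta> y)"
  using assms
proof (induction "card (parcs G)" arbitrary: G rule: less_induct)
  case less
  interpret G: gain_graph G \<phi> by fact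
  show ?case
  proof (cases "parcs G = {}")
    case True
    then show ?thesis by (intro exI[of _ "\<lambda>_. 1"]) simp
  next
    case False
    then obtain x y where xy: "(x, y) \<in> parcs G" by auto
    have yx: "(y, x) \<in> parcs G" using xy by (rule G.arcs_symmetric)
    have neq: "x \<noteq> y" using G.no_loops'[OF xy] .
    define H where "H = delete_edges G {{x, y}}"
    have parcsH: "parcs H = parcs G - {(x, y), (y, x)}"
      by (auto simp: H_def delete_edges_def doubleton_eq_iff)
    have pvertsH: "pverts H = pverts G" by (simp add: H_def delete_edges_def)
    interpret H: gain_graph H \<phi>
      unfolding H_def using less.prems(1) by (rule gain_graph_delete_edges)
    have "card (parcs H) < card (parcs G)"
      by (rule psubset_card_mono) (use xy G.pair_finite_arcs in \<open>auto simp: parcsH\<close>)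
    moreover have "balanced H \<phi>"
      using less.prems(2) by (rule balanced_subgraph) (auto simp: pvertsH parcsH)
    ultimately obtain \<theta> where unit: "\<And>z. cmod (\<theta> z) = 1"
      and pot: "\<And>z w. (z, w) \<in> parcs H \<Longrightarrow> \<theta> z = \<phi> (z, w) * \<theta> w"
      using less.hyps[of H] H.gain_graph_axioms by blast
    have arcs_cases: "(z, w) \<in> parcs H \<or> (z = x \<and> w = y) \<or> (z = y \<and> w = x)"
      if "(z, w) \<in> parcs G" for z w
      using that by (auto simp: parcsH)
    have nz: "\<theta> z \<noteq> 0" for z using unit[of z] by auto
    show ?thesis
    proof (cases "y \<rightarrow>\<^sup>*\<^bsub>with_proj H\<^esub> x")
      case True
      \<comment> \<open>A path rather than a walk: its vertices are distinct, as the closed walk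
        built from it must be a cycle.\<close>
      then obtain p where p: "H.apath y p x" using H.reachable_apath by blast
      then have walk: "H.awalk y p x" and dist: "distinct (pawalk_verts y p)"
        by (auto simp: H.apath_def)
      \<comment> \<open>\<open>p\<close> is not empty since \<open>x \<noteq> y\<close>, and not a
        single arc since \<open>(y, x)\<close> was removed. Closing it with \<open>(x, y)\<close>
        thus gives length at least 3, as \<open>balanced\<close> demands.\<close>
      have "p \<noteq> []" using walk neq by (auto simp: H.awalk_Nil_iff)
      moreover have "length p \<noteq> 1"
      proof
        assume "length p = 1"
        then obtain e where "p = [e]" by (auto simp: length_Suc_conv)
        then show False using walk by (cases e) (auto simp: H.awalk_Cons_iff H.awalk_Nil_iff parcsH)
      qed
      ultimately have len: "2 \<le> length p" by (cases p) (auto simp: neq_Nil_conv Suc_le_eq)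
      have "G.awalk y p x"
        using walk by (auto simp: G.awalk_def H.awalk_def pvertsH parcsH)
      then have "G.awalk x ((x, y) # p) x" using xy by (simp add: G.awalk_Cons_iff)
      then have "G.cycle ((x, y) # p)"
        using dist unfolding G.cycle_def by auto
      then have "walk_gain \<phi> ((x, y) # p) = 1"
        using less.prems(2) len by (auto simp: balanced_def)
      \<comment> \<open>Multiplied by \<open>\<phi> (x, y)\<close>, the gain of \<open>p\<close>
        becomes the gain 1 of the cycle, which yields the equation on \<open>(x, y)\<close>.\<close>
      moreover have "\<theta> y = walk_gain \<phi> p * \<theta> x"
        using H.potential_along_awalk[OF pot walk] by simp
      ultimately have 1: "\<theta> x = \<phi> (x, y) * \<theta> y"
        by (simp add: walk_gain_def mult.assoc[symmetric])
      then have 2: "\<theta> y = \<phi> (y, x) * \<theta> x"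
        using G.gain_mult_reverse[OF yx] by (simp add: mult.assoc[symmetric])
      show ?thesis using unit pot 1 2 arcs_cases by (intro exI[of _ \<theta>]) blast
    next
      case False
      define C where "C = {z. y \<rightarrow>\<^sup>*\<^bsub>with_proj H\<^esub> z}"
      \<comment> \<open>Solves the equation on \<open>(y, x)\<close> after rescaling at
        \<open>y\<close> only; a product and quotient of units, it has modulus 1.\<close>
      define c where "c = \<phi> (y, x) * \<theta> x / \<theta> y"
      define \<theta>' where "\<theta>' = (\<lambda>z. if z \<in> C then c * \<theta> z else \<theta> z)"
      have C: "w \<in> C" if "z \<in> C" "(z, w) \<in> parcs H" for z w
        using that H.reachable_adj_trans[of y z w] by (simp add: C_def)
      have yC: "y \<in> C" and xC: "x \<notin> C"
        using False G.in_arcsD2[OF xy] by (auto simp: C_def pvertsH)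
      have "cmod c = 1"
        using unit G.gain_unit[OF yx] by (simp add: c_def norm_divide norm_mult)
      then have unit': "cmod (\<theta>' z) = 1" for z
        using unit by (simp add: \<theta>'_def norm_mult)
      have 2: "\<theta>' y = \<phi> (y, x) * \<theta>' x"
        using yC xC nz by (simp add: \<theta>'_def c_def)
      then have 1: "\<theta>' x = \<phi> (x, y) * \<theta>' y"
        using G.gain_mult_reverse[OF xy] by (simp add: mult.assoc[symmetric])
      \<comment> \<open>By symmetry of the arcs, no arc of \<open>H\<close> enters or leaves
        \<open>C\<close>, so both ends of an arc are scaled by the same factor.\<close>
      have pot': "\<theta>' z = \<phi> (z, w) * \<theta>' w" if "(z, w) \<in> parcs H" for z w
        using pot[OF that] C[OF _ that] C[OF _ H.arcs_symmetric[OF that]]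
        by (auto simp: \<theta>'_def)
      show ?thesis using unit' pot' 1 2 arcs_cases by (intro exI[of _ \<theta>']) blast
    qed
  qed
qed

section \<open>Frustration number and frustration index\<close>

lemma balanced_no_arcs: "parcs G = {} \<Longrightarrow> balanced G \<phi>"
  by (auto simp: balanced_def pre_digraph.cycle_def pre_digraph.awalk_def)

text \<open>Deleting all vertices is always admissible, so the \<open>LEAST\<close> ranges over a
  nonempty set and is attained.\<close>

lemma frustration_number_witness:
  obtains S where "S \<subseteq> pverts G" "card S = frustration_number G \<phi>"
    "balanced (delete_verts G S) \<phi>"
proof -
  have "balanced (delete_verts G (pverts G)) \<phi>"
    unfolding balanced_def pre_digraph.cycle_def pre_digraph.awalk_def
    by (auto simp: delete_verts_def)
  then have "\<exists>k S. S \<subseteq> pverts G \<and> card S = k \<and> balanced (delete_verts G S) \<phi>"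
    by blast
  from LeastI_ex[OF this] show thesis
    by (auto simp: frustration_number_def[symmetric] intro: that)
qed

lemma frustration_number_le:
  "S \<subseteq> pverts G \<Longrightarrow> balanced (delete_verts G S) \<phi> \<Longrightarrow> frustration_number G \<phi> \<le> card S"
  unfolding frustration_number_def by (rule Least_le) blast

lemma (in gain_graph) frustration_index_witness:
  obtains F where "F \<subseteq> undirected_edges G" "card F = frustration_index G \<phi>"
    "balanced (delete_edges G F) \<phi>"
proof -
  have "balanced (delete_edges G (undirected_edges G)) \<phi>"
    by (rule balanced_no_arcs) (auto simp: delete_edges_def undirected_edges_def)
  then have "\<exists>k F. F \<subseteq> undirected_edges G \<and> card F = k \<and> balanced (delete_edges G F) \<phi>"
    by blast
  from LeastI_ex[OF this] show thesis
    by (auto simp: frustration_index_def[symmetric] intro: that)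
qed

text \<open>A single remaining vertex carries no arcs, there being no loops. Strictness makes the
  test vector of the main estimate nonzero.\<close>

lemma (in gain_graph) frustration_number_less_order:
  assumes "pverts G \<noteq> {}"
  shows "frustration_number G \<phi> < card (pverts G)"
proof -
  obtain r where r: "r \<in> pverts G" using assms by blast
  let ?S = "pverts G - {r}"
  have "parcs (delete_verts G ?S) = {}"
    using in_arcsD1 in_arcsD2 no_loops' by (fastforce simp: delete_verts_def)
  then have "frustration_number G \<phi> \<le> card ?S"
    by (intro frustration_number_le balanced_no_arcs) auto
  also have "\<dots> < card (pverts G)"
    by (rule psubset_card_mono[OF pair_finite_verts]) (use r in blast)
  finally show ?thesis .
qed

lemma (in gain_graph) frustration_number_le_index:
  "frustration_number G \<phi> \<le> frustration_index G \<phi>"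
proof -
  obtain F where F: "F \<subseteq> undirected_edges G" "card F = frustration_index G \<phi>"
    "balanced (delete_edges G F) \<phi>"
    by (rule frustration_index_witness)
  define r where "r = (\<lambda>e :: 'a set. SOME x. x \<in> e)"
  have r: "r e \<in> e" if "e \<in> F" for e
  proof -
    have "e \<noteq> {}" using that F(1) by (auto simp: undirected_edges_def)
    then show ?thesis by (auto simp: r_def intro: someI_ex)
  qed
  have "undirected_edges G \<subseteq> Pow (pverts G)"
    using in_arcsD1 in_arcsD2 by (auto simp: undirected_edges_def)
  then have sub: "r ` F \<subseteq> pverts G" and fin: "finite F"
    using F(1) r pair_finite_verts by (blast, meson finite_Pow_iff finite_subset)
  have "balanced (delete_verts G (r ` F)) \<phi>"
    using F(3)
  proof (rule balanced_subgraph)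
    \<comment> \<open>An edge in \<open>F\<close> loses its chosen endpoint, so it cannot survive
      the vertex deletion.\<close>
    show "parcs (delete_verts G (r ` F)) \<subseteq> parcs (delete_edges G F)"
    proof
      fix a assume a: "a \<in> parcs (delete_verts G (r ` F))"
      obtain x y where xy: "a = (x, y)" by (cases a)
      with a have "(x, y) \<in> parcs G" "x \<notin> r ` F" "y \<notin> r ` F"
        by (auto simp: delete_verts_def)
      moreover from this have "{x, y} \<notin> F" using r[of "{x, y}"] by (metis image_eqI insertE singletonD)
      ultimately show "a \<in> parcs (delete_edges G F)"
        by (simp add: xy delete_edges_def)
    qed
  qed (auto simp: delete_verts_def delete_edges_def)
  with sub have "frustration_number G \<phi> \<le> card (r ` F)" by (rule frustration_number_le)
  \<comment> \<open>Only an inequality, since several edges may share their chosen endpoint.\<close>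
  also have "\<dots> \<le> card F" using fin by (rule card_image_le)
  finally show ?thesis by (simp add: F(2))
qed

section \<open>The Rayleigh bound tested on the extended potential\<close>

lemma smallest_eigenvalue_le_frustration_number:
  fixes G :: "'a pair_pre_digraph" and \<phi> :: "'a \<times> 'a \<Rightarrow> complex"
    and n :: nat and v :: "nat \<Rightarrow> 'a"
  assumes "gain_graph G \<phi>"
    and "1 \<le> n"
    and bij: "bij_betw v {..<n} (pverts G)"
  shows "smallest_eigenvalue (gain_laplacian G \<phi> n v) \<le> real (frustration_number G \<phi>)"
proof -
  interpret G: gain_graph G \<phi> by fact
  let ?L = "gain_laplacian G \<phi> n v"
  obtain S where S: "S \<subseteq> pverts G" "card S = frustration_number G \<phi>"
    and bal: "balanced (delete_verts G S) \<phi>"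
    by (rule frustration_number_witness)
  obtain \<theta> where unit: "\<And>x. cmod (\<theta> x) = 1"
    and pot: "\<And>x y. (x, y) \<in> parcs (delete_verts G S) \<Longrightarrow> \<theta> x = \<phi> (x, y) * \<theta> y"
    using balanced_potential[OF gain_graph_delete_verts[OF assms(1)] bal] by blast
  define f where "f = (\<lambda>i. if v i \<in> S then 0 else \<theta> (v i))"
  define c where "c = (\<lambda>i. card {j. j < n \<and> v j \<in> S \<and> (v i, v j) \<in> parcs G})"
  define I where "I = {i. i < n \<and> v i \<notin> S}"
  \<comment> \<open>Transfers counts of vertices to counts of matrix indices.\<close>
  have reindex: "card {y. y \<in> pverts G \<and> P y} = card {j. j < n \<and> P (v j)}" for P
  proof -
    have "bij_betw v {j. j < n \<and> P (v j)} {y. y \<in> pverts G \<and> P y}"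
      by (rule bij_betw_subset[OF bij]) (use bij in \<open>auto simp: bij_betw_def\<close>)
    then show ?thesis by (metis bij_betw_same_card)
  qed
  have cardS: "card {j. j < n \<and> v j \<in> S} = card S"
    using reindex[of "\<lambda>y. y \<in> S"] S(1) by (simp add: Collect_conj_eq Int_absorb1)
  have cardV: "card (pverts G) = n"
    using bij_betw_same_card[OF bij] by simp
  have cardI: "card I = n - card S"
  proof -
    have "I = {..<n} - {j. j < n \<and> v j \<in> S}" by (auto simp: I_def)
    then show ?thesis using cardS by (simp add: card_Diff_subset subset_iff)
  qed
  have c_le: "c i \<le> card S" for i
    unfolding c_def cardS[symmetric] by (rule card_mono) auto
  have degree: "out_degree (with_proj G) (v i) = card {j. j < n \<and> (v i, v j) \<in> parcs G}" for i
  proof -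
    have "out_arcs (with_proj G) (v i) = Pair (v i) ` {y. y \<in> pverts G \<and> (v i, y) \<in> parcs G}"
      using G.in_arcsD2 by (auto simp: out_arcs_def)
    then show ?thesis
      using reindex[of "\<lambda>y. (v i, y) \<in> parcs G"]
      by (simp add: out_degree_def card_image inj_on_def)
  qed
  \<comment> \<open>The diagonal gives the degree times \<open>\<theta> (v i)\<close>, and each
    neighbour outside \<open>S\<close> cancels one \<open>\<theta> (v i)\<close> by the potential
    equation. Neighbours in \<open>S\<close> cancel nothing because \<open>f\<close> vanishes there;
    \<open>c i\<close> counts them.\<close>
  have image: "(\<Sum>j<n. ?L $$ (i, j) * f j) = of_nat (c i) * \<theta> (v i)" if i: "i \<in> I" for i
  proof -
    have i': "i < n" "v i \<notin> S" using i by (auto simp: I_def)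
    let ?A = "{j. j < n \<and> (v i, v j) \<in> parcs G}"
    let ?B = "{j. j < n \<and> v j \<in> S \<and> (v i, v j) \<in> parcs G}"
    have "(\<Sum>j<n. ?L $$ (i, j) * f j)
      = (\<Sum>j<n. (if i = j then of_nat (card ?A) * f j else 0)
          - (if (v i, v j) \<in> parcs G then \<phi> (v i, v j) * f j else 0))"
      using i' by (intro sum.cong)
        (auto simp: gain_laplacian_def degree_matrix_def adjacency_matrix_def degree left_diff_distrib)
    also have "\<dots> = of_nat (card ?A) * f i
        - (\<Sum>j<n. if (v i, v j) \<in> parcs G then \<phi> (v i, v j) * f j else 0)"
      using i' by (simp add: sum_subtractf)
    also have "(\<Sum>j<n. if (v i, v j) \<in> parcs G then \<phi> (v i, v j) * f j else 0)
      = (\<Sum>j \<in> ?A. \<phi> (v i, v j) * f j)"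
      by (simp add: sum.inter_filter[symmetric])
    also have "\<dots> = (\<Sum>j \<in> ?A - ?B. \<phi> (v i, v j) * f j)"
      by (rule sum.mono_neutral_right) (auto simp: f_def)
    also have "\<dots> = (\<Sum>j \<in> ?A - ?B. \<theta> (v i))"
      using i' by (intro sum.cong) (auto simp: f_def delete_verts_def intro!: pot[symmetric])
    also have "\<dots> = (of_nat (card ?A) - of_nat (card ?B)) * \<theta> (v i)"
      by (subst sum_constant, subst card_Diff_subset)
        (auto simp: of_nat_diff card_mono Collect_mono)
    finally show ?thesis
      using i' by (simp add: f_def c_def algebra_simps)
  qed
  have "herm_form n (\<lambda>i j. ?L $$ (i, j)) f f
      = (\<Sum>i<n. cnj (f i) * (\<Sum>j<n. ?L $$ (i, j) * f j))"
    by (rule herm_form_eq_sum_image)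
  \<comment> \<open>Rows in \<open>S\<close> are killed by the factor \<open>cnj (f i) = 0\<close>,
    so knowing the image on \<open>I\<close> is enough.\<close>
  also have "\<dots> = (\<Sum>i\<in>I. cnj (f i) * (\<Sum>j<n. ?L $$ (i, j) * f j))"
    by (rule sum.mono_neutral_right) (auto simp: I_def f_def)
  also have "\<dots> = (\<Sum>i\<in>I. of_nat (c i))"
  proof (rule sum.cong[OF refl])
    fix i assume i: "i \<in> I"
    have "cnj (\<theta> (v i)) * \<theta> (v i) = 1"
      using unit[of "v i"] complex_norm_square[of "\<theta> (v i)"] by (simp add: mult.commute)
    then show "cnj (f i) * (\<Sum>j<n. ?L $$ (i, j) * f j) = of_nat (c i)"
      using i by (simp add: image) (simp add: I_def f_def mult.left_commute)
  qed
  finally have form: "Re (herm_form n (\<lambda>i j. ?L $$ (i, j)) f f) = (\<Sum>i\<in>I. real (c i))"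
    by simp
  have "(\<Sum>i<n. (cmod (f i))\<^sup>2) = (\<Sum>i\<in>I. (cmod (f i))\<^sup>2)"
    by (rule sum.mono_neutral_right) (auto simp: I_def f_def)
  also have "\<dots> = (\<Sum>i\<in>I. 1)"
    by (rule sum.cong) (auto simp: I_def f_def unit)
  finally have norm: "(\<Sum>i<n. (cmod (f i))\<^sup>2) = real (card I)" by simp
  have "smallest_eigenvalue ?L * (\<Sum>i<n. (cmod (f i))\<^sup>2)
      \<le> Re (herm_form n (\<lambda>i j. ?L $$ (i, j)) f f)"
    using assms(2)
  proof (rule smallest_eigenvalue_le_rayleigh[rotated])
    show "?L \<in> carrier_mat n n"
      unfolding gain_laplacian_def degree_matrix_def adjacency_matrix_def
      by (intro minus_carrier_mat mat_carrier)
  qed (rule gain_laplacian_hermitian[OF assms(1)])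
  also have "\<dots> \<le> (\<Sum>i\<in>I. real (card S))"
    unfolding form by (rule sum_mono) (simp add: c_le)
  finally have "smallest_eigenvalue ?L * real (card I) \<le> real (card S) * real (card I)"
    by (simp add: norm mult.commute)
  \<comment> \<open>Allows \<open>card I\<close> to be cancelled from the inequality.\<close>
  moreover have "0 < card I"
  proof -
    have "pverts G \<noteq> {}" using cardV assms(2) by auto
    from G.frustration_number_less_order[OF this] show ?thesis
      by (simp add: S(2) cardV cardI)
  qed
  ultimately show ?thesis by (simp add: S(2))
qed

theorem theorem3p1:
  fixes G :: "'a pair_pre_digraph" and \<phi> :: "'a \<times> 'a \<Rightarrow> complex"
    and n :: nat and v :: "nat \<Rightarrow> 'a"
  assumes "gain_graph G \<phi>"
    and "1 \<le> n"
    and "bij_betw v {..<n} (pverts G)"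
  shows "smallest_eigenvalue (gain_laplacian G \<phi> n v) \<le> real (frustration_number G \<phi>)
    \<and> smallest_eigenvalue (gain_laplacian G \<phi> n v) \<le> real (frustration_index G \<phi>)"
proof -
  interpret G: gain_graph G \<phi> by fact
  show ?thesis
    using smallest_eigenvalue_le_frustration_number[OF assms] G.frustration_number_le_index
    by linarith
qed

end
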